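(* Let $P$ be a convex Euclidean $n$-gon where $n\ge 7$. There exists a placement of the puncture $p$ in the interior of $P$ such that, for some triangulations $U$ and $V$ of the resulting punctured polygon $P^\star$, no geodesic of $\overline{\mathcal{F}}(P^\star)$ between $U$ and $V$ is entirely contained in $\mathcal{F}(P^\star)$.
   Context: Let $P$ be a convex Euclidean $n$-gon, and let $P^\star$ denote $P$ together with a chosen point $p$ in its interior, called the puncture. The marked points of $P$ are its vertices; the marked points of $P^\star$ are the vertices of $P$ and $p$. For each of $P$ and $P^\star$, an arc is a Euclidean line segment joining two distinct marked points with no marked point in its interior; two arcs are non-crossing if their interiors are disjoint; a triangulation is a maximal set of pairwise non-crossing arcs (including the boundary edges of $P$). The flip-graphs $\mathcal{F}(P)$ and $\mathcal{F}(P^\star)$ have as vertices the triangulations of $P$, respectively of $P^\star$, with two triangulations joined by an edge when they differ by a single arc. Flipping the puncture into a triangulation $T$ of $P$ means the following. If $p$ lies in the interior of a triangle $t$ of $T$, add the three segments joining $p$ to the vertices of $t$. If $p$ lies on an edge $\varepsilon$ of $T$, remove $\varepsilon$ and add the four segments joining $p$ to the vertices of the quadrilateral formed by the two triangles of $T$ incident to $\varepsilon$. In both cases the result is a triangulation of $P^\star$. The graph $\overline{\mathcal{F}}(P^\star)$ is obtained from the disjoint union of $\mathcal{F}(P)$ and $\mathcal{F}(P^\star)$ by adding an edge between a triangulation $T$ of $P$ and a triangulation $T'$ of $P^\star$ whenever $T'$ is obtained by flipping the puncture into $T$. Thus $\mathcal{F}(P^\star)$ is naturally a subgraph of $\overline{\mathcal{F}}(P^\star)$.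 A geodesic in a graph is a shortest path between its endpoints. *)

theory Defs
  imports "HOL-Analysis.Analysis" "Graph_Theory.Graph_Theory"
begin

type_synonym point = "real^2"

definition vertices :: "point set \<Rightarrow> point set" where
  "vertices P = {v. v extreme_point_of P}"

(* The polygon includes its interior; all its n vertices are genuine corners. *)
definition convex_ngon :: "nat \<Rightarrow> point set \<Rightarrow> bool" where
  "convex_ngon n P \<longleftrightarrow> polytope P \<and> aff_dim P = 2 \<and> card (vertices P) = n"

(* The notions up to the flip-graph are parameterized by the set M of marked points:
   M = vertices P for P, and M = insert p (vertices P) for P punctured at p. *)

(* An arc is the point set of its segment, so it has no orientation. *)
definition marked_arcs :: "point set \<Rightarrow> point set set" where
  "marked_arcs M =
     {closed_segment a b | a b. a \<in> M \<and> b \<in> M \<and> a \<noteq> b \<and> open_segment a b \<inter> M = {}}"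

(* The interior of an arc is taken relative to the arc: the segment without its endpoints. *)
definition noncrossing :: "point set \<Rightarrow> point set \<Rightarrow> bool" where
  "noncrossing s t \<longleftrightarrow> rel_interior s \<inter> rel_interior t = {}"

definition noncrossing_arc_sets :: "point set \<Rightarrow> point set set set" where
  "noncrossing_arc_sets M = {T. T \<subseteq> marked_arcs M \<and> pairwise noncrossing T}"

(* Boundary edges cross no arc, so maximality forces them into every triangulation. *)
definition triangulations :: "point set \<Rightarrow> point set set set" where
  "triangulations M =
     {T \<in> noncrossing_arc_sets M. \<forall>T' \<in> noncrossing_arc_sets M. T \<subseteq> T' \<longrightarrow> T' = T}"

definition differ_by_one_arc :: "point set set \<Rightarrow> point set set \<Rightarrow> bool" where
  "differ_by_one_arc T T' \<longleftrightarrow> (\<exists>e f. T - T' = {e} \<and> T' - T = {f})"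

(* Undirected graphs are represented by symmetric sets of ordered pairs. *)
definition flip_graph :: "point set \<Rightarrow> point set set pair_pre_digraph" where
  "flip_graph M = \<lparr>pverts = triangulations M,
     parcs = {(T, T'). T \<in> triangulations M \<and> T' \<in> triangulations M \<and> differ_by_one_arc T T'}\<rparr>"

(* The vertices of a polygon are its only marked points, so three of them whose
   connecting segments all belong to T span a face of T. *)
definition triangle_of :: "point set set \<Rightarrow> point \<Rightarrow> point \<Rightarrow> point \<Rightarrow> bool" where
  "triangle_of T a b c \<longleftrightarrow> a \<noteq> b \<and> b \<noteq> c \<and> a \<noteq> c \<and>
     closed_segment a b \<in> T \<and> closed_segment b c \<in> T \<and> closed_segment a c \<in> T"

(* Here T is a triangulation of the unpunctured polygon. In the second case the triangles
   incident to the edge ab are abc and abd. *)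
definition flips_puncture_into :: "point \<Rightarrow> point set set \<Rightarrow> point set set \<Rightarrow> bool" where
  "flips_puncture_into p T T' \<longleftrightarrow>
     (\<exists>a b c. triangle_of T a b c \<and> p \<in> interior (convex hull {a, b, c}) \<and>
        T' = T \<union> {closed_segment p a, closed_segment p b, closed_segment p c}) \<or>
     (\<exists>a b c d. triangle_of T a b c \<and> triangle_of T a b d \<and> c \<noteq> d \<and> p \<in> open_segment a b \<and>
        T' = (T - {closed_segment a b}) \<union>
          {closed_segment p a, closed_segment p b, closed_segment p c, closed_segment p d})"

definition extended_flip_graph ::
    "point set \<Rightarrow> point \<Rightarrow> (point set set + point set set) pair_pre_digraph" where
  "extended_flip_graph P p =
    (let F = flip_graph (vertices P);
         F' = flip_graph (insert p (vertices P));
         E = {(T, T'). T \<in> pverts F \<and> T' \<in> pverts F' \<and> flips_puncture_into p T T'}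
     in \<lparr>pverts = pverts F <+> pverts F',
         parcs = map_prod Inl Inl ` parcs F \<union> map_prod Inr Inr ` parcs F' \<union>
           map_prod Inl Inr ` E \<union> (map_prod Inl Inr ` E)\<inverse>\<rparr>)"

definition path_between :: "'a pair_pre_digraph \<Rightarrow> 'a \<Rightarrow> 'a list \<Rightarrow> 'a \<Rightarrow> bool" where
  "path_between G u g v \<longleftrightarrow> vpath g (with_proj G) \<and> hd g = u \<and> last g = v"

definition geodesic :: "'a pair_pre_digraph \<Rightarrow> 'a \<Rightarrow> 'a list \<Rightarrow> 'a \<Rightarrow> bool" where
  "geodesic G u g v \<longleftrightarrow> path_between G u g v \<and>
     (\<forall>h. path_between G u h v \<longrightarrow> vwalk_length g \<le> vwalk_length h)"

end

theory Submission
  imports Defs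
begin

text \<open>
  A walk inside the flip-graph of the punctured polygon that goes from \<open>U\<close> to \<open>V\<close> has at
  least \<open>card (U - V)\<close> steps, because a flip removes a single arc. Take six vertices, numbered from
  0 to 5 counterclockwise. The triangles 035 and 124 share no vertex, but their interiors meet; let
  \<open>p\<close> be a common interior point. The hexagon triangulation with diagonals 03, 35, 13 is taken
  to the one with diagonals 04, 14, 24 by only three flips, and the former contains the triangle 035
  while the latter contains 124. Puncturing both at \<open>p\<close> gives \<open>U\<close> and \<open>V\<close>. Outside
  the hexagon they agree, and \<open>U - V\<close> consists of the three diagonals and the three arcs at
  \<open>p\<close>, so their distance in the flip-graph of the punctured polygon is at least 6. Flipping the
  puncture out, doing the three flips and flipping it back in takes 5 steps.
\<close>

section \<open>Orientation and convex position\<close>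

lemma DIM_point: "DIM(point) = 2"
  by simp

text \<open>Twice the signed area of the triangle with these corners, positive exactly when they are
  in counterclockwise order.\<close>

definition orient :: "point \<Rightarrow> point \<Rightarrow> point \<Rightarrow> real" where
  "orient a b c = (b$1 - a$1) * (c$2 - a$2) - (b$2 - a$2) * (c$1 - a$1)"

lemma orient_rotate: "orient b c a = orient a b c"
  by (simp add: orient_def algebra_simps)

lemma orient_swap: "orient b a c = - orient a b c"
  by (simp add: orient_def algebra_simps)

lemma orient_flip: "orient a c b = - orient a b c"
  by (simp add: orient_def algebra_simps)

lemma orient_same [simp]: "orient a a b = 0" "orient a b a = 0" "orient b a a = 0"
  by (simp_all add: orient_def)

lemma orient_affine:
  assumes "u + v = 1"
  shows "orient a b (u *\<^sub>R x + v *\<^sub>R y) = u * orient a b x + v * orient a b y"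
proof -
  have u: "u = 1 - v" using assms by simp
  show ?thesis unfolding u by (simp add: orient_def algebra_simps)
qed

text \<open>Both sides are twice the signed area of the quadrilateral \<open>a b c d\<close>, cut
  along \<open>b d\<close> on the left and along \<open>a c\<close> on the right.\<close>

lemma orient_cocycle: "orient b c d + orient a b d = orient a c d + orient a b c"
  by (simp add: orient_def algebra_simps)

text \<open>Cramer's rule: the unnormalised barycentric coordinates of \<open>x\<close> are the
  signed areas of the triangles that \<open>x\<close> spans with the opposite sides.\<close>

lemma barycentric:
  "orient a b c *\<^sub>R x = orient b c x *\<^sub>R a + orient c a x *\<^sub>R b + orient a b x *\<^sub>R c"
  by (simp add: vec_eq_iff forall_2 orient_def algebra_simps)

lemma collinear_imp_orient:
  assumes "collinear {a, b, c}" shows "orient a b c = 0"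
proof -
  from assms obtain u where u: "\<And>x y. x \<in> {a,b,c} \<Longrightarrow> y \<in> {a,b,c} \<Longrightarrow> \<exists>k. x - y = k *\<^sub>R u"
    unfolding collinear_def by blast
  obtain k l where "b - a = k *\<^sub>R u" "c - a = l *\<^sub>R u" using u[of b a] u[of c a] by auto
  then have "b = a + k *\<^sub>R u" "c = a + l *\<^sub>R u" by (simp_all add: diff_eq_eq add.commute)
  then show ?thesis by (simp add: orient_def)
qed

text \<open>The three positive areas add up to that of the whole triangle, so the triangle is
  nondegenerate and dividing \<open>barycentric\<close> by its area writes \<open>x\<close> as a
  convex combination with positive weights.\<close>

lemma in_triangle:
  assumes "orient a b x > 0" "orient b c x > 0" "orient c a x > 0"
  shows "x \<in> interior (convex hull {a, b, c})"
proof -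
  have sum: "orient a b c = orient b c x + orient c a x + orient a b x"
    by (simp add: orient_def algebra_simps)
  then have pos: "orient a b c > 0" using assms by simp
  have nc: "\<not> collinear {a, b, c}"
    using collinear_imp_orient[of a b c] pos by auto
  define S where "S = orient a b c"
  define u v w where "u = orient b c x / S" "v = orient c a x / S" "w = orient a b x / S"
  have "S *\<^sub>R x = orient b c x *\<^sub>R a + orient c a x *\<^sub>R b + orient a b x *\<^sub>R c"
    unfolding S_def by (rule barycentric)
  then have "inverse S *\<^sub>R S *\<^sub>R x =
      inverse S *\<^sub>R (orient b c x *\<^sub>R a + orient c a x *\<^sub>R b + orient a b x *\<^sub>R c)"
    by (rule arg_cong)
  then have "u *\<^sub>R a + v *\<^sub>R b + w *\<^sub>R c = x"
    using pos by (simp add: S_def u_v_w_def scaleR_add_right divide_inverse_commute)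
  moreover have "u + v + w = 1"
    using pos unfolding u_v_w_def S_def by (simp add: sum flip: add_divide_distrib)
  moreover have "0 < u" "0 < v" "0 < w"
    using assms pos by (simp_all add: u_v_w_def S_def)
  ultimately show ?thesis
    unfolding interior_convex_hull_3_minimal[OF nc DIM_point] by blast
qed

lemma orient_imp_collinear:
  assumes "orient a b c = 0"
  shows "collinear {a, b, c}"
proof (cases "a = b")
  case False
  then have "\<exists>i. b$i \<noteq> a$i" by (metis vec_eq_iff)
  then obtain i where i: "b$i \<noteq> a$i" ..
  define k where "k = (c$i - a$i) / (b$i - a$i)"
  \<comment> \<open>For \<open>i = j\<close> both sides agree up to commutativity; for distinct
    indices this is the vanishing of the determinant.\<close>
  have "(c$j - a$j) * (b$i - a$i) = (c$i - a$i) * (b$j - a$j)" for j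
  proof -
    have "(b$1 - a$1) * (c$2 - a$2) = (b$2 - a$2) * (c$1 - a$1)"
      using assms unfolding orient_def by (simp only: right_minus_eq)
    then show ?thesis
      apply -
      apply (rule disjE[OF exhaust_2[of i]])
       apply (rule_tac [!] disjE[OF exhaust_2[of j]])
       apply (simp_all only: mult.commute)
      done
  qed
  then have "c$j - a$j = k * (b$j - a$j)" for j
    using i by (simp add: k_def eq_divide_eq)
  then have "c - a = k *\<^sub>R (b - a)"
    by (simp add: vec_eq_iff)
  then have "c = a + k *\<^sub>R (b - a)"
    by (metis add_diff_cancel_left' diff_add_cancel add.commute)
  also have "\<dots> = (1 - k) *\<^sub>R a + (1 - (1 - k)) *\<^sub>R b"
    by (simp add: algebra_simps)
  finally have "c = (1 - k) *\<^sub>R a + (1 - (1 - k)) *\<^sub>R b" .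
  then have "collinear {a, c, b}"
    unfolding collinear_3_expand by blast
  then show ?thesis by (simp add: insert_commute)
qed simp

section \<open>Sets in convex position and their counterclockwise order\<close>

definition convexly_independent :: "'a::real_vector set \<Rightarrow> bool" where
  "convexly_independent M \<longleftrightarrow> (\<forall>a\<in>M. a \<notin> convex hull (M - {a}))"

text \<open>Deleting an extreme point from \<open>P\<close> leaves a convex set, which therefore
  contains the hull of the remaining vertices.\<close>

lemma convexly_independent_vertices: "convexly_independent (vertices P)" if "convex P"
  unfolding convexly_independent_def
proof
  fix a assume "a \<in> vertices P"
  then have a: "a extreme_point_of P" by (simp add: vertices_def)
  have "vertices P - {a} \<subseteq> P - {a}"
    by (auto simp: vertices_def extreme_point_of_def)
  moreover have "convex (P - {a})"
    using a that extreme_point_of_stillconvex by blast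
  ultimately have "convex hull (vertices P - {a}) \<subseteq> P - {a}"
    by (simp add: hull_minimal)
  then show "a \<notin> convex hull (vertices P - {a})" by blast
qed

lemma not_in_triangle:
  assumes "convexly_independent M" "x \<in> M" "{a, b, c} \<subseteq> M" "x \<notin> {a, b, c}"
  shows "x \<notin> convex hull {a, b, c}"
proof -
  have "convex hull {a, b, c} \<subseteq> convex hull (M - {x})"
    using assms by (intro hull_mono) auto
  then show ?thesis using assms unfolding convexly_independent_def by blast
qed

lemma not_in_segment:
  assumes "convexly_independent M" "x \<in> M" "a \<in> M" "b \<in> M" "x \<noteq> a" "x \<noteq> b"
  shows "x \<notin> closed_segment a b"
  using not_in_triangle[of M x a b b] assms by (simp add: segment_convex_hull)

lemma open_segment_Int_independent:
  assumes "convexly_independent M" "a \<in> M" "b \<in> M"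
  shows "open_segment a b \<inter> M = {}"
  using not_in_segment[OF assms(1)] assms by (auto simp: open_segment_def)

lemma not_collinear_independent:
  fixes M :: "'a::euclidean_space set"
  assumes "convexly_independent M" "a \<in> M" "b \<in> M" "c \<in> M" "a \<noteq> b" "b \<noteq> c" "a \<noteq> c"
  shows "\<not> collinear {a, b, c}"
  using not_in_segment[OF assms(1)] assms
  by (auto simp: collinear_between_cases between_mem_segment)

lemma orient_nonzero:
  assumes "convexly_independent M" "a \<in> M" "b \<in> M" "c \<in> M" "a \<noteq> b" "b \<noteq> c" "a \<noteq> c"
  shows "orient a b c \<noteq> 0"
  using not_collinear_independent[OF assms] orient_imp_collinear by blast

text \<open>The angular order around \<open>a\<close> is transitive: otherwise the triangles
  \<open>a x y\<close>, \<open>a y z\<close> and \<open>a z x\<close> would all be counterclockwise,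
  which puts \<open>a\<close> inside the triangle \<open>x y z\<close>.\<close>

lemma orient_pos_trans:
  assumes "convexly_independent M" "a \<in> M" "x \<in> M" "y \<in> M" "z \<in> M"
    and "orient a x y > 0" "orient a y z > 0"
  shows "orient a x z > 0"
proof (rule ccontr)
  assume n: "\<not> orient a x z > 0"
  have "a \<noteq> x" "a \<noteq> y" "a \<noteq> z" using assms(6,7) by auto
  moreover have "x \<noteq> z" using assms(6,7) orient_flip[of a x y] by auto
  ultimately have "orient a x z \<noteq> 0" using orient_nonzero assms(1-5) by metis
  with n have "orient z x a > 0"
    using orient_flip[of a x z] orient_rotate[of z x a] by simp
  then have "a \<in> convex hull {x, y, z}"
    using in_triangle[of x y a z] assms(6,7) interior_subset orient_rotate[of x y a] orient_rotate[of y z a] by auto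
  then show False
    using not_in_triangle[of M a x y z] assms \<open>a \<noteq> x\<close> \<open>a \<noteq> y\<close> \<open>a \<noteq> z\<close> by auto
qed

text \<open>Otherwise \<open>y\<close> would lie inside the triangle \<open>a x z\<close>.\<close>

lemma orient_pos_of_sorted:
  assumes "convexly_independent M" "a \<in> M" "x \<in> M" "y \<in> M" "z \<in> M"
    and "orient a x y > 0" "orient a y z > 0"
  shows "orient x y z > 0"
proof (rule ccontr)
  assume n: "\<not> orient x y z > 0"
  have xz: "orient a x z > 0" using assms by (rule orient_pos_trans)
  have d: "y \<noteq> a" "y \<noteq> x" "y \<noteq> z" "x \<noteq> z" using assms(6,7) xz by auto
  then have "orient x y z \<noteq> 0" using orient_nonzero assms(1-5) by metis
  with n have "orient x z y > 0"
    using orient_flip[of x y z] by simp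
  then have "y \<in> convex hull {a, x, z}"
    using in_triangle[of a x y z] assms(6,7) interior_subset orient_rotate[of z a y] orient_rotate[of y z a] by auto
  then show False using not_in_triangle[of M y a x z] assms d by auto
qed

text \<open>Sorting for a relation that is total and transitive only on \<open>A\<close>, as the
  angular order around a fixed point is. The new element goes between the elements below it and the
  others.\<close>

lemma finite_sorted_wrt_list:
  assumes "finite A"
    and "\<And>x y. x \<in> A \<Longrightarrow> y \<in> A \<Longrightarrow> x \<noteq> y \<Longrightarrow> r x y \<or> r y x"
    and "\<And>x y z. x \<in> A \<Longrightarrow> y \<in> A \<Longrightarrow> z \<in> A \<Longrightarrow> r x y \<Longrightarrow> r y z \<Longrightarrow> r x z"
  shows "\<exists>xs. set xs = A \<and> sorted_wrt r xs"
  using assms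
proof (induction rule: finite_induct)
    case (insert x A)
    have "\<exists>xs. set xs = A \<and> sorted_wrt r xs"
    proof (rule insert.IH)
      show "r y z \<or> r z y" if "y \<in> A" "z \<in> A" "y \<noteq> z" for y z
        using insert.prems(1)[of y z] that by simp
      show "r w z" if "w \<in> A" "y \<in> A" "z \<in> A" "r w y" "r y z" for w y z
        using insert.prems(2)[of w y z] that by simp
    qed
    then obtain xs where xs: "set xs = A" "sorted_wrt r xs" by blast
    let ?ys = "filter (\<lambda>y. r y x) xs @ x # filter (\<lambda>y. \<not> r y x) xs"
    have above: "r x y" if "y \<in> A" "\<not> r y x" for y
      using insert.prems(1)[of x y] insert.hyps(2) that by auto
    have across: "r y z" if "y \<in> A" "z \<in> A" "r y x" "\<not> r z x" for y z
      using insert.prems(2)[of y x z] above[of z] that by simp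
    have "set ?ys = insert x A" using xs(1) by auto
    moreover have "sorted_wrt r ?ys"
      unfolding sorted_wrt_append sorted_wrt.simps
      using xs sorted_wrt_filter[OF xs(2)] above across by simp
    ultimately show ?case by blast
  next
    case empty
    show ?case by (rule exI[of _ "[]"]) simp
qed

text \<open>All increasing triples are constrained, not only consecutive ones. This encodes convex
  position together with the cyclic order, and it passes to every prefix.\<close>

definition ccw_points :: "nat \<Rightarrow> (nat \<Rightarrow> point) \<Rightarrow> bool" where
  "ccw_points n v \<longleftrightarrow> (\<forall>i j k. i < j \<longrightarrow> j < k \<longrightarrow> k < n \<longrightarrow> orient (v i) (v j) (v k) > 0)"

text \<open>Start at any point \<open>a\<close> and sort the others by angle around it.\<close>

lemma counterclockwise_enumeration:
  assumes ci: "convexly_independent M" and "finite M"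
  obtains v where "set v = M" "length v \<ge> card M" "ccw_points (length v) ((!) v)"
proof (cases "M = {}")
  case True
  then show thesis using that[of "[]"] by (simp add: ccw_points_def)
next
  case False
  then obtain a where a: "a \<in> M" by blast
  have "\<exists>xs. set xs = M - {a} \<and> sorted_wrt (\<lambda>x y. orient a x y > 0) xs"
  proof (rule finite_sorted_wrt_list[of "M - {a}" "\<lambda>x y. orient a x y > 0"])
    fix x y assume "x \<in> M - {a}" "y \<in> M - {a}" "x \<noteq> y"
    then have "orient a x y \<noteq> 0" using orient_nonzero[OF ci a] by blast
    moreover have "orient a y x = - orient a x y" by (rule orient_flip)
    ultimately show "orient a x y > 0 \<or> orient a y x > 0" by linarith
  next
    fix x y z assume "x \<in> M - {a}" "y \<in> M - {a}" "z \<in> M - {a}"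
    then show "orient a x y > 0 \<Longrightarrow> orient a y z > 0 \<Longrightarrow> orient a x z > 0"
      using orient_pos_trans[OF ci a] by blast
  qed (simp add: \<open>finite M\<close>)
  then obtain xs where xs: "set xs = M - {a}" "sorted_wrt (\<lambda>x y. orient a x y > 0) xs" by blast
  have srt: "orient a (xs ! i) (xs ! j) > 0" if "i < j" "j < length xs" for i j
    using sorted_wrt_nth_less[OF xs(2)] that by blast
  show thesis
  proof (rule that[of "a # xs"])
    show "set (a # xs) = M" using xs a by auto
    then show "card M \<le> length (a # xs)" by (metis card_length)
    show "ccw_points (length (a # xs)) ((!) (a # xs))"
      unfolding ccw_points_def
    proof (intro allI impI)
      fix i j k :: nat assume ijk: "i < j" "j < k" "k < length (a # xs)"
      then obtain j' k' where jk: "j = Suc j'" "k = Suc k'" by (metis less_imp_Suc_add)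
      show "orient ((a # xs) ! i) ((a # xs) ! j) ((a # xs) ! k) > 0"
      \<comment> \<open>A triple starting with \<open>a\<close> is counterclockwise by the sorting;
        any other triple lies in \<open>xs\<close> and is handled by comparison with
        \<open>a\<close>.\<close>
      proof (cases i)
        case 0
        then show ?thesis using jk ijk srt by simp
      next
        case (Suc i')
        have m: "xs ! l \<in> M" if "l < length xs" for l using that xs(1) nth_mem by blast
        show ?thesis
          using orient_pos_of_sorted[OF ci a, of "xs ! i'" "xs ! j'" "xs ! k'"] m srt jk ijk Suc
          by simp
      qed
    qed
  qed
qed

text \<open>A segment is connected, so on its way out it meets the frontier, which is the union of
  the sides. The meeting point is neither the interior point \<open>q\<close> nor the outer point
  \<open>x\<close>.\<close>

lemma exits_triangle:
  fixes a :: point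
  assumes "q \<in> interior (convex hull {a, b, c})" "x \<notin> convex hull {a, b, c}"
  obtains z where "z \<in> open_segment q x"
    "z \<in> closed_segment a b \<union> closed_segment b c \<union> closed_segment c a"
proof -
  have "q \<in> closed_segment q x \<inter> convex hull {a, b, c}" using assms(1) interior_subset by auto
  moreover have "x \<in> closed_segment q x - convex hull {a, b, c}" using assms(2) by simp
  ultimately have "closed_segment q x \<inter> frontier (convex hull {a, b, c}) \<noteq> {}"
    by (intro connected_Int_frontier) (blast intro: connected_segment)+
  then obtain z where z: "z \<in> closed_segment q x" "z \<in> frontier (convex hull {a, b, c})" by blast
  have "frontier (convex hull {a, b, c}) \<subseteq> convex hull {a, b, c}"
    by (simp add: frontier_subset_closed compact_imp_closed finite_imp_compact_convex_hull)
  then have "z \<noteq> q" "z \<noteq> x" using z assms by (auto simp: frontier_def)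
  then have "z \<in> open_segment q x" using z by (simp add: open_segment_def)
  moreover have "z \<in> closed_segment a b \<union> closed_segment b c \<union> closed_segment c a"
    using z(2) by (simp add: frontier_of_triangle)
  ultimately show thesis by (rule that)
qed

section \<open>Triangulations and flips\<close>

lemma noncrossing_segments:
  assumes "a \<noteq> b" "c \<noteq> d"
  shows "noncrossing (closed_segment a b) (closed_segment c d) \<longleftrightarrow>
    open_segment a b \<inter> open_segment c d = {}"
  using assms by (simp add: noncrossing_def rel_interior_closed_segment)

lemma noncrossing_commute: "noncrossing s t \<longleftrightarrow> noncrossing t s"
  by (simp add: noncrossing_def Int_commute)

lemma triangle_ofD:
  assumes "triangle_of T a b c" "d \<in> {a, b, c}" "e \<in> {a, b, c}" "d \<noteq> e"
  shows "closed_segment d e \<in> T"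
proof -
  have "closed_segment a b \<in> T" "closed_segment b c \<in> T" "closed_segment a c \<in> T"
    using assms(1) unfolding triangle_of_def by simp_all
  moreover from this have "closed_segment b a \<in> T" "closed_segment c b \<in> T" "closed_segment c a \<in> T"
    by (simp_all only: closed_segment_commute)
  ultimately show ?thesis using assms(2-4) by blast
qed

lemma in_open_side:
  assumes "z \<in> closed_segment a b \<union> closed_segment b c \<union> closed_segment c a"
    "z \<notin> {a, b, c}"
  obtains d e where "d \<in> {a, b, c}" "e \<in> {a, b, c}" "d \<noteq> e" "z \<in> open_segment d e"
proof -
  have "z \<in> open_segment d e \<and> d \<noteq> e"
    if "z \<in> closed_segment d e" "d \<in> {a, b, c}" "e \<in> {a, b, c}" for d e
    using that assms(2) by (cases "d = e") (auto simp: open_segment_def)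
  then show thesis using assms(1) that by blast
qed

text \<open>If the arc passes through an interior point of the triangle, each of its ends must be a
  corner, since otherwise it would leave through the relative interior of a side. An arc joining two
  corners is a side, however, and sides miss the interior. Exempting the arc itself in the last
  hypothesis makes this applicable to arcs of \<open>T\<close> as well as to new ones.\<close>

lemma avoids_triangle:
  assumes ci: "convexly_independent M" and T: "triangle_of T a b c" and abc: "{a, b, c} \<subseteq> M"
    and xy: "x \<in> M" "y \<in> M" "x \<noteq> y"
    and nc: "\<And>s. s \<in> T \<Longrightarrow> s \<noteq> closed_segment x y \<Longrightarrow> noncrossing s (closed_segment x y)"
  shows "open_segment x y \<inter> interior (convex hull {a, b, c}) = {}"
proof (rule ccontr)
  assume "\<not> ?thesis"
  then obtain q where q: "q \<in> open_segment x y" "q \<in> interior (convex hull {a, b, c})" by blast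
  have corner: "u \<in> {a, b, c}" if u: "u \<in> {x, y}" for u
  proof (rule ccontr)
    assume nu: "u \<notin> {a, b, c}"
    have "u \<in> M" using u xy by blast
    then have "u \<notin> convex hull {a, b, c}" using not_in_triangle[OF ci _ abc nu] by blast
    then obtain z where z: "z \<in> open_segment q u"
        "z \<in> closed_segment a b \<union> closed_segment b c \<union> closed_segment c a"
      using exits_triangle[OF q(2)] by blast
    have "open_segment q u \<subseteq> open_segment x y"
      unfolding subset_open_segment using q(1) u subsetD[OF segment_open_subset_closed q(1)] by auto
    then have zxy: "z \<in> open_segment x y" using z by blast
    then have zn: "z \<notin> {a, b, c}" using open_segment_Int_independent[OF ci xy(1,2)] abc by blast
    obtain d e where de: "d \<in> {a, b, c}" "e \<in> {a, b, c}" "d \<noteq> e" "z \<in> open_segment d e"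
      by (rule in_open_side[OF z(2) zn])
    \<comment> \<open>The two segments cross at \<open>z\<close>, so they can only be one and the
      same arc, and then \<open>u\<close> is a corner after all.\<close>
    have "closed_segment d e = closed_segment x y"
      using nc[OF triangle_ofD[OF T de(1-3)]] zxy de(3,4) xy(3) by (auto simp: noncrossing_segments)
    then have "{d, e} = {x, y}" by simp
    then show False using u nu de by blast
  qed
  then have "x \<in> {a, b, c}" "y \<in> {a, b, c}" by blast+
  then have "closed_segment x y \<in> {closed_segment a b, closed_segment b c, closed_segment c a}"
    using xy(3) by (auto simp: doubleton_eq_iff)
  then have "open_segment x y \<subseteq> closed_segment a b \<union> closed_segment b c \<union> closed_segment c a"
    using segment_open_subset_closed[of x y] by blast
  then show False using q by (auto simp: interior_of_triangle)
qed

section \<open>Exchanging the diagonals of a quadrilateral\<close>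

lemma open_segment_in_triangle:
  fixes a :: point
  assumes "\<not> collinear {a, b, c}" "q \<in> open_segment a c"
  shows "open_segment b q \<subseteq> interior (convex hull {a, b, c})"
proof
  fix z assume "z \<in> open_segment b q"
  then obtain t where t: "0 < t" "t < 1" "z = (1 - t) *\<^sub>R b + t *\<^sub>R q" by (auto simp: in_segment)
  obtain s where s: "0 < s" "s < 1" "q = (1 - s) *\<^sub>R a + s *\<^sub>R c" using assms by (auto simp: in_segment)
  have "(t * (1 - s)) *\<^sub>R a + (1 - t) *\<^sub>R b + (t * s) *\<^sub>R c = z"
    unfolding t s by (simp add: algebra_simps)
  moreover have "t * (1 - s) + (1 - t) + t * s = 1" by (simp add: algebra_simps)
  moreover have "0 < t * (1 - s)" "0 < 1 - t" "0 < t * s" using s t by auto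
  ultimately show "z \<in> interior (convex hull {a, b, c})"
    unfolding interior_convex_hull_3_minimal[OF assms(1) DIM_point] by blast
qed

text \<open>The crossing point \<open>q\<close> cuts \<open>b d\<close> into two segments, each
  running inside one of the two triangles on \<open>a c\<close>. Exchanging the roles of the
  diagonals covers \<open>a c\<close> in the same way.\<close>

lemma diagonal_subset:
  fixes a :: point
  assumes "\<not> collinear {a, b, c}" "\<not> collinear {a, d, c}"
    and q: "q \<in> open_segment a c" "q \<in> open_segment b d"
  shows "open_segment b d \<subseteq> interior (convex hull {a, b, c}) \<union> interior (convex hull {a, d, c}) \<union> open_segment a c"
proof
  fix z assume z: "z \<in> open_segment b d"
  have "closed_segment b q \<union> closed_segment q d = closed_segment b d"
    using q(2) by (intro Un_closed_segment) (auto simp: open_segment_def)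
  then have "z \<in> open_segment b q \<union> open_segment d q \<union> {q}"
    using z by (auto simp: open_segment_def closed_segment_commute)
  then show "z \<in> interior (convex hull {a, b, c}) \<union> interior (convex hull {a, d, c}) \<union> open_segment a c"
    using open_segment_in_triangle[OF assms(1) q(1)] open_segment_in_triangle[OF assms(2) q(1)] q
    by blast
qed

lemma segment_from_interior:
  fixes p :: point
  assumes "p \<in> interior (convex hull {a, b, c})" "x \<in> {a, b, c}"
  shows "open_segment p x \<subseteq> interior (convex hull {a, b, c})"
proof (rule in_interior_closure_convex_segment)
  show "x \<in> closure (convex hull {a, b, c})"
    using assms(2) closure_subset hull_inc[of x "{a, b, c}" convex] by blast
qed (use assms(1) in simp_all)

lemma interior_triangle_Int_independent:
  fixes M :: "point set"
  assumes ci: "convexly_independent M" and abc: "{a, b, c} \<subseteq> M"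
  shows "interior (convex hull {a, b, c}) \<inter> M = {}"
proof -
  have False if x: "x \<in> M" "x \<in> interior (convex hull {a, b, c})" for x
  proof -
    have "x \<in> {a, b, c}" using not_in_triangle[OF ci x(1) abc] x(2) interior_subset by blast
    then show False using x(2) by (auto simp: interior_of_triangle)
  qed
  then show ?thesis by blast
qed

lemma marked_arc_independent:
  assumes "convexly_independent M" "a \<in> M" "b \<in> M" "a \<noteq> b"
  shows "closed_segment a b \<in> marked_arcs M"
  using open_segment_Int_independent[OF assms(1-3)] assms(2-4) unfolding marked_arcs_def by blast

lemma marked_arcE:
  assumes "g \<in> marked_arcs M"
  obtains x y where "g = closed_segment x y" "x \<in> M" "y \<in> M" "x \<noteq> y" "open_segment x y \<inter> M = {}"
  using assms unfolding marked_arcs_def by blast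

lemma triangulationD:
  assumes "T \<in> triangulations M"
  shows "T \<subseteq> marked_arcs M" "\<And>s t. s \<in> T \<Longrightarrow> t \<in> T \<Longrightarrow> s \<noteq> t \<Longrightarrow> noncrossing s t"
  using assms unfolding triangulations_def noncrossing_arc_sets_def pairwise_def by blast+

lemma triangulation_maximal:
  assumes T: "T \<in> triangulations M" and g: "g \<in> marked_arcs M"
    and nc: "\<And>s. s \<in> T \<Longrightarrow> s \<noteq> g \<Longrightarrow> noncrossing s g"
  shows "g \<in> T"
proof -
  have "insert g T \<subseteq> marked_arcs M" using triangulationD(1)[OF T] g by blast
  moreover have "pairwise noncrossing (insert g T)"
    using triangulationD(2)[OF T] nc noncrossing_commute unfolding pairwise_def by blast
  ultimately have "insert g T \<in> noncrossing_arc_sets M" by (simp add: noncrossing_arc_sets_def)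
  then have "insert g T = T" using T unfolding triangulations_def by blast
  then show ?thesis by blast
qed

text \<open>Maximality can be tested on single arcs, because each member of a larger noncrossing set
  is compatible with all of \<open>T\<close>.\<close>

lemma triangulationI:
  assumes "T \<subseteq> marked_arcs M" "\<And>s t. s \<in> T \<Longrightarrow> t \<in> T \<Longrightarrow> s \<noteq> t \<Longrightarrow> noncrossing s t"
    and max: "\<And>g. g \<in> marked_arcs M \<Longrightarrow> (\<And>s. s \<in> T \<Longrightarrow> s \<noteq> g \<Longrightarrow> noncrossing s g) \<Longrightarrow> g \<in> T"
  shows "T \<in> triangulations M"
proof -
  have "T' = T" if T': "T' \<in> noncrossing_arc_sets M" "T \<subseteq> T'" for T'
  proof -
    have "g \<in> T" if g: "g \<in> T'" for g
    proof (rule max)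
      show "g \<in> marked_arcs M" using g T'(1) unfolding noncrossing_arc_sets_def by blast
      show "noncrossing s g" if "s \<in> T" "s \<noteq> g" for s
        using that T' g unfolding noncrossing_arc_sets_def pairwise_def by blast
    qed
    then show ?thesis using T'(2) by blast
  qed
  moreover have "T \<in> noncrossing_arc_sets M"
    using assms(1,2) unfolding noncrossing_arc_sets_def pairwise_def by blast
  ultimately show ?thesis unfolding triangulations_def by blast
qed

text \<open>Arcs compatible with either triangulation avoid the interiors of its two triangles in
  the quadrilateral, and each diagonal is covered by the two triangles on the other diagonal and
  that diagonal itself. Hence \<open>T\<close> and \<open>T'\<close> admit the same arcs apart from
  the two diagonals, and maximality carries over.\<close>

lemma flip_triangulation:
  fixes M :: "point set"
  assumes ci: "convexly_independent M" and T: "T \<in> triangulations M"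
    and abcd: "a \<in> M" "b \<in> M" "c \<in> M" "d \<in> M" "b \<noteq> d"
    and tri: "triangle_of T a b c" "triangle_of T a d c"
    and q: "q \<in> open_segment a c" "q \<in> open_segment b d"
  defines "T' \<equiv> insert (closed_segment b d) (T - {closed_segment a c})"
  shows "T' \<in> triangulations M" "differ_by_one_arc T T'"
proof -
  let ?e = "closed_segment a c" and ?f = "closed_segment b d"
  have ne: "a \<noteq> b" "b \<noteq> c" "a \<noteq> c" "a \<noteq> d" "d \<noteq> c" using tri by (auto simp: triangle_of_def)
  have eT: "?e \<in> T" using tri(1) by (simp add: triangle_of_def)
  have nc: "\<not> collinear {a, b, c}" "\<not> collinear {a, d, c}" "\<not> collinear {b, a, d}" "\<not> collinear {b, c, d}"
    using not_collinear_independent[OF ci] abcd ne by metis+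
  have cross: "\<not> noncrossing ?e ?f"
    using q noncrossing_segments[OF ne(3) abcd(5)] by blast
  have ef: "?e \<noteq> ?f" using ne by (simp add: doubleton_eq_iff)
  have fT: "?f \<notin> T" using triangulationD(2)[OF T eT] ef cross by blast
  have fsub: "open_segment b d \<subseteq> interior (convex hull {a, b, c}) \<union> interior (convex hull {a, d, c}) \<union> open_segment a c"
    by (rule diagonal_subset[OF nc(1,2) q])
  have esub: "open_segment a c \<subseteq> interior (convex hull {b, a, d}) \<union> interior (convex hull {b, c, d}) \<union> open_segment b d"
    by (rule diagonal_subset[OF nc(3,4) q(2,1)])
  have tri': "triangle_of T' b a d" "triangle_of T' b c d"
  proof -
    have s: "closed_segment x y \<in> T'" if "{x, y} \<noteq> {a, c}" "closed_segment x y \<in> T" for x y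
      using that unfolding T'_def by simp
    have "closed_segment b a \<in> T" "closed_segment b c \<in> T" "closed_segment a d \<in> T" "closed_segment c d \<in> T"
      using triangle_ofD[OF tri(1)] triangle_ofD[OF tri(2)] ne by auto
    then have "closed_segment b a \<in> T'" "closed_segment b c \<in> T'" "closed_segment a d \<in> T'" "closed_segment c d \<in> T'"
      using ne by (auto intro!: s simp: doubleton_eq_iff)
    moreover have "?f \<in> T'" by (simp add: T'_def)
    ultimately show "triangle_of T' b a d" "triangle_of T' b c d"
      using ne abcd(5) unfolding triangle_of_def by auto
  qed
  \<comment> \<open>The new diagonal crosses no other arc of \<open>T\<close>: such an arc avoids
    both triangles on the old diagonal, and the old diagonal as well.\<close>
  have f: "noncrossing g ?f" if g: "g \<in> T" "g \<noteq> ?e" for g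
  proof -
    obtain x y where xy: "g = closed_segment x y" "x \<in> M" "y \<in> M" "x \<noteq> y"
      by (rule marked_arcE[OF subsetD[OF triangulationD(1)[OF T] g(1)]])
    have gn: "noncrossing s (closed_segment x y)" if "s \<in> T" "s \<noteq> closed_segment x y" for s
      using triangulationD(2)[OF T that(1)] g(1) that(2) unfolding xy(1) by blast
    have "open_segment x y \<inter> interior (convex hull {a, b, c}) = {}"
      using avoids_triangle[OF ci tri(1) _ xy(2-4) gn] abcd by simp
    moreover have "open_segment x y \<inter> interior (convex hull {a, d, c}) = {}"
      using avoids_triangle[OF ci tri(2) _ xy(2-4) gn] abcd by simp
    moreover have "open_segment x y \<inter> open_segment a c = {}"
      using gn[OF eT] g(2) noncrossing_segments[OF ne(3) xy(4)] unfolding xy(1) by blast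
    ultimately show ?thesis
      unfolding xy(1) noncrossing_segments[OF xy(4) abcd(5)] using fsub by blast
  qed
  show "T' \<in> triangulations M"
  proof (rule triangulationI)
    show "T' \<subseteq> marked_arcs M"
      using triangulationD(1)[OF T] marked_arc_independent[OF ci abcd(2,4,5)] unfolding T'_def by blast
    show "noncrossing s t" if "s \<in> T'" "t \<in> T'" "s \<noteq> t" for s t
      using that f noncrossing_commute triangulationD(2)[OF T] unfolding T'_def by blast
    fix g assume g: "g \<in> marked_arcs M" and comp: "\<And>s. s \<in> T' \<Longrightarrow> s \<noteq> g \<Longrightarrow> noncrossing s g"
    obtain x y where xy: "g = closed_segment x y" "x \<in> M" "y \<in> M" "x \<noteq> y"
      by (rule marked_arcE[OF g])
    have gn: "noncrossing s (closed_segment x y)" if "s \<in> T'" "s \<noteq> closed_segment x y" for s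
      using comp that unfolding xy(1) by blast
    have i1: "open_segment x y \<inter> interior (convex hull {b, a, d}) = {}"
      using avoids_triangle[OF ci tri'(1) _ xy(2-4) gn] abcd by simp
    have i2: "open_segment x y \<inter> interior (convex hull {b, c, d}) = {}"
      using avoids_triangle[OF ci tri'(2) _ xy(2-4) gn] abcd by simp
    have fT': "?f \<in> T'" by (simp add: T'_def)
    \<comment> \<open>Compatibility with the old diagonal is all that is missing for the maximality
      of \<open>T\<close>; it follows from the covering \<open>esub\<close> by triangles of
      \<open>T'\<close>.\<close>
    have gT: "g \<in> T" if nf: "g \<noteq> ?f"
    proof (rule triangulation_maximal[OF T g])
      fix s assume s: "s \<in> T" "s \<noteq> g"
      have "open_segment x y \<inter> open_segment b d = {}"
        using gn[OF fT'] nf noncrossing_segments[OF abcd(5) xy(4)] unfolding xy(1) by blast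
      with i1 i2 esub have "open_segment a c \<inter> open_segment x y = {}" by blast
      then have "noncrossing ?e g"
        unfolding xy(1) noncrossing_segments[OF ne(3) xy(4)] .
      moreover have "noncrossing s g" if "s \<noteq> ?e"
      proof (rule comp)
        show "s \<in> T'" using s(1) that by (simp add: T'_def)
      qed (rule s(2))
      ultimately show "noncrossing s g" by blast
    qed
    have "g \<noteq> ?e"
    proof
      assume "g = ?e"
      then have "noncrossing ?f ?e" using comp[OF fT'] ef by simp
      then show False using cross noncrossing_commute by blast
    qed
    then show "g \<in> T'" using gT unfolding T'_def by blast
  qed
  have "T - T' = {?e}" "T' - T = {?f}" using eT fT ef unfolding T'_def by auto
  then show "differ_by_one_arc T T'" unfolding differ_by_one_arc_def by blast
qed

section \<open>Inserting the puncture into a triangulation\<close>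

lemma open_segments_same_origin:
  assumes "z \<in> open_segment p a" "z \<in> open_segment p b"
  shows "a = b \<or> a \<in> open_segment p b \<or> b \<in> open_segment p a"
proof -
  obtain s where s: "0 < s" "s < 1" "z = (1 - s) *\<^sub>R p + s *\<^sub>R a" and pa: "p \<noteq> a"
    using assms(1) unfolding in_segment by blast
  obtain t where t: "0 < t" "t < 1" "z = (1 - t) *\<^sub>R p + t *\<^sub>R b" and pb: "p \<noteq> b"
    using assms(2) unfolding in_segment by blast
  \<comment> \<open>Both \<open>a\<close> and \<open>b\<close> lie on the ray from \<open>p\<close>
    through \<open>z\<close>; comparing \<open>s\<close> with \<open>t\<close> tells which of them
    is nearer to \<open>p\<close>.\<close>
  have eq: "s *\<^sub>R (a - p) = t *\<^sub>R (b - p)"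
    using s(3) t(3) by (simp add: algebra_simps)
  have scale: "v = (1 - r / k) *\<^sub>R p + (r / k) *\<^sub>R u"
    if "r *\<^sub>R (u - p) = k *\<^sub>R (v - p)" "k > 0" for r k u v
  proof -
    have "inverse k *\<^sub>R k *\<^sub>R (v - p) = inverse k *\<^sub>R r *\<^sub>R (u - p)" using that(1) by simp
    then have "v - p = (r / k) *\<^sub>R (u - p)"
      using that(2) by (simp add: divide_inverse_commute)
    then have "v = p + (r / k) *\<^sub>R (u - p)" by (metis add.commute diff_add_cancel)
    then show ?thesis by (simp add: algebra_simps)
  qed
  consider "s = t" | "s < t" | "t < s" by linarith
  then show ?thesis
  proof cases
    case 1
    then have "a - p = b - p" using eq s(1) by simp
    then show ?thesis by simp
  next
    case 2
    then have "b \<in> open_segment p a"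
      unfolding in_segment using pa scale[OF eq t(1)] s(1)
      by (intro conjI exI[of _ "s / t"]) simp_all
    then show ?thesis by blast
  next
    case 3
    then have "a \<in> open_segment p b"
      unfolding in_segment using pb scale[OF eq[symmetric] s(1)] t(1)
      by (intro conjI exI[of _ "t / s"]) simp_all
    then show ?thesis by blast
  qed
qed

text \<open>The new segments run inside the open triangle, which no arc of \<open>T\<close> enters.
  For maximality, an arc between points of \<open>M\<close> is governed by the maximality of
  \<open>T\<close>, while an arc from \<open>p\<close> to a vertex other than a corner would have to
  cross a side of the triangle.\<close>

lemma puncture_triangulation:
  fixes M :: "point set"
  assumes ci: "convexly_independent M" and T: "T \<in> triangulations M"
    and tri: "triangle_of T a b c" and abc: "{a, b, c} \<subseteq> M"
    and p: "p \<in> interior (convex hull {a, b, c})"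
  shows "T \<union> {closed_segment p a, closed_segment p b, closed_segment p c} \<in> triangulations (insert p M)"
    (is "?T' \<in> _")
proof -
  let ?I = "interior (convex hull {a, b, c})"
  have IM: "?I \<inter> M = {}" using interior_triangle_Int_independent[OF ci abc] .
  then have pM: "p \<notin> M" using p by blast
  have T': "g \<in> ?T' \<longleftrightarrow> g \<in> T \<or> (\<exists>x \<in> {a, b, c}. g = closed_segment p x)" for g by blast
  have spoke: "open_segment p x \<subseteq> ?I" if "x \<in> {a, b, c}" for x
    using segment_from_interior[OF p that] .
  have TI: "open_segment x y \<inter> ?I = {}" if "closed_segment x y \<in> T" "x \<in> M" "y \<in> M" "x \<noteq> y" for x y
    using avoids_triangle[OF ci tri abc that(2-4)] triangulationD(2)[OF T] that(1) by blast
  have TE: "\<exists>x y. g = closed_segment x y \<and> x \<in> M \<and> y \<in> M \<and> x \<noteq> y" if "g \<in> T" for g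
    by (rule marked_arcE[OF subsetD[OF triangulationD(1)[OF T] that]]) blast
  have Tspoke: "noncrossing g (closed_segment p x)" if g: "g \<in> T" and x: "x \<in> {a, b, c}" for g x
  proof -
    obtain u v where uv: "g = closed_segment u v" "u \<in> M" "v \<in> M" "u \<noteq> v" using TE[OF g] by blast
    have "p \<noteq> x" using x abc pM by blast
    then show ?thesis
      unfolding uv(1) noncrossing_segments[OF uv(4) \<open>p \<noteq> x\<close>]
      using TI[of u v] uv g spoke[OF x] by blast
  qed
  have spokes: "noncrossing (closed_segment p x) (closed_segment p y)"
    if xy: "x \<in> {a, b, c}" "y \<in> {a, b, c}" "x \<noteq> y" for x y
  proof -
    have n: "p \<noteq> x" "p \<noteq> y" "x \<in> M" "y \<in> M" using xy abc pM by blast+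
    \<comment> \<open>Two overlapping segments from \<open>p\<close> would put the end of one inside
      the other, hence a point of \<open>M\<close> inside the triangle.\<close>
    have "z \<notin> open_segment p y" if "z \<in> open_segment p x" for z
      using open_segments_same_origin[OF that, of y] xy n spoke IM by blast
    then show ?thesis unfolding noncrossing_segments[OF n(1,2)] by blast
  qed
  show ?thesis
  proof (rule triangulationI)
    show "?T' \<subseteq> marked_arcs (insert p M)"
    proof
      fix g assume "g \<in> ?T'"
      then consider "g \<in> T" | x where "x \<in> {a, b, c}" "g = closed_segment p x" unfolding T' by blast
      then show "g \<in> marked_arcs (insert p M)"
      proof cases
        case 1
        then obtain u v where uv: "g = closed_segment u v" "u \<in> M" "v \<in> M" "u \<noteq> v" using TE by blast
        have "open_segment u v \<inter> insert p M = {}"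
          using open_segment_Int_independent[OF ci uv(2,3)] TI[of u v] uv 1 p by blast
        then show ?thesis using uv unfolding marked_arcs_def by blast
      next
        case 2
        have "p \<notin> open_segment p x" by (simp add: open_segment_def)
        then have "open_segment p x \<inter> insert p M = {}" using spoke[OF 2(1)] IM by blast
        moreover have "x \<in> M" "p \<noteq> x" using 2(1) abc pM by blast+
        ultimately show ?thesis unfolding marked_arcs_def 2(2) by blast
      qed
    qed
    show "noncrossing s t" if "s \<in> ?T'" "t \<in> ?T'" "s \<noteq> t" for s t
    proof -
      have ex: "\<exists>x\<in>{a, b, c}. g = closed_segment p x" if "g \<in> ?T'" "g \<notin> T" for g
        using that unfolding T' by blast
      show ?thesis
      proof (cases "s \<in> T")
        case True
        show ?thesis
        proof (cases "t \<in> T")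
          case t: True
          show ?thesis using triangulationD(2)[OF T True t that(3)] .
        next
          case False
          then obtain x where "x \<in> {a, b, c}" "t = closed_segment p x" using ex[OF \<open>t \<in> ?T'\<close>] by blast
          then show ?thesis using Tspoke[OF True] by simp
        qed
      next
        case False
        then obtain x where x: "x \<in> {a, b, c}" "s = closed_segment p x" using ex[OF \<open>s \<in> ?T'\<close>] by blast
        show ?thesis
        proof (cases "t \<in> T")
          case True
          then show ?thesis using Tspoke[OF True x(1)] x(2) noncrossing_commute[of s t] by simp
        next
          case False
          then obtain y where y: "y \<in> {a, b, c}" "t = closed_segment p y" using ex[OF \<open>t \<in> ?T'\<close>] by blast
          have "x \<noteq> y" using that(3) x(2) y(2) by blast
          then show ?thesis using spokes[OF x(1) y(1)] x(2) y(2) by simp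
        qed
      qed
    qed
    fix g assume g: "g \<in> marked_arcs (insert p M)"
      and comp: "\<And>s. s \<in> ?T' \<Longrightarrow> s \<noteq> g \<Longrightarrow> noncrossing s g"
    have arc_from_p: "closed_segment p x \<in> ?T'"
      if x: "x \<in> M" "open_segment p x \<inter> insert p M = {}" "g = closed_segment p x" for x
    proof (rule ccontr)
      assume "closed_segment p x \<notin> ?T'"
      then have nx: "x \<notin> {a, b, c}" by blast
      have "x \<notin> convex hull {a, b, c}" using not_in_triangle[OF ci x(1) abc nx] .
      then obtain z where z: "z \<in> open_segment p x"
          "z \<in> closed_segment a b \<union> closed_segment b c \<union> closed_segment c a"
        using exits_triangle[OF p] by blast
      have zn: "z \<notin> {a, b, c}" using z(1) x(2) abc by blast
      obtain d e where de: "d \<in> {a, b, c}" "e \<in> {a, b, c}" "d \<noteq> e" "z \<in> open_segment d e"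
        by (rule in_open_side[OF z(2) zn])
      \<comment> \<open>The side that is crossed has both ends in \<open>M\<close>, so it differs
        from \<open>g\<close>, which ends at \<open>p\<close>.\<close>
      have "p \<notin> {d, e}" using de abc pM by blast
      then have "closed_segment d e \<noteq> g" unfolding x(3) closed_segment_eq by blast
      then have "noncrossing (closed_segment d e) (closed_segment p x)"
        using comp triangle_ofD[OF tri de(1-3)] x(3) by blast
      moreover have "p \<noteq> x" using x(1) pM by blast
      ultimately show False using de(3,4) z(1) noncrossing_segments by blast
    qed
    obtain x y where xy: "g = closed_segment x y" "x \<in> insert p M" "y \<in> insert p M" "x \<noteq> y"
        "open_segment x y \<inter> insert p M = {}"
      by (rule marked_arcE[OF g])
    consider "x \<in> M" "y \<in> M" | "x = p" "y \<in> M" | "y = p" "x \<in> M" using xy by blast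
    then show "g \<in> ?T'"
    proof cases
      case 1
      then have "g \<in> marked_arcs M" using xy unfolding marked_arcs_def by blast
      then have "g \<in> T" using triangulation_maximal[OF T] comp by blast
      then show ?thesis by blast
    next
      case 2
      then show ?thesis using arc_from_p[of y] xy by simp
    next
      case 3
      then show ?thesis using arc_from_p[of x] xy by (simp add: closed_segment_commute open_segment_commute)
    qed
  qed
qed

text \<open>There are only finitely many arcs, so \<open>S\<close> lies in a maximal noncrossing
  set.\<close>

lemma triangulation_extending:
  assumes "finite M" "S \<in> noncrossing_arc_sets M"
  obtains T where "T \<in> triangulations M" "S \<subseteq> T"
proof -
  have "marked_arcs M \<subseteq> (\<lambda>(a, b). closed_segment a b) ` (M \<times> M)"
    unfolding marked_arcs_def by auto
  then have "finite (marked_arcs M)" using assms(1) finite_subset by blast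
  then have "finite (noncrossing_arc_sets M)"
    unfolding noncrossing_arc_sets_def by (rule_tac finite_subset[of _ "Pow (marked_arcs M)"]) auto
  then obtain T where T: "T \<in> noncrossing_arc_sets M" "S \<subseteq> T"
      "\<forall>T' \<in> noncrossing_arc_sets M. T \<subseteq> T' \<longrightarrow> T = T'"
    using finite_has_maximal2[OF _ assms(2)] by blast
  then have "T \<in> triangulations M" unfolding triangulations_def by auto
  then show thesis using T(2) by (rule that)
qed

section \<open>Chords between points in counterclockwise order\<close>

text \<open>The hypotheses say that \<open>a b c d\<close> is a counterclockwise convex
  quadrilateral. The crossing point is computed explicitly, from ratios of areas.\<close>

lemma crossing_diagonals:
  assumes "orient b c d > 0" "orient a b d > 0" "orient a c d > 0" "orient a b c > 0"
  obtains q where "q \<in> open_segment a c" "q \<in> open_segment b d"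
proof -
  define S where "S = orient b c d + orient a b d"
  have S: "S > 0" "S = orient a c d + orient a b c"
    using assms orient_cocycle[of b c d a] by (simp_all add: S_def)
  \<comment> \<open>The line \<open>b d\<close> cuts \<open>a c\<close> in the ratio of the
    distances of \<open>a\<close> and \<open>c\<close> from it, which is the ratio of the areas of
    the triangles over the base \<open>b d\<close>; \<open>t\<close> arises likewise from the base
    \<open>a c\<close>.\<close>
  define s where "s = orient a b d / S"
  define t where "t = orient a b c / S"
  have s: "0 < s" "s < 1" using assms S(1) by (simp_all add: s_def S_def)
  have t: "0 < t" "t < 1" using assms S by (simp_all add: t_def)
  have ac: "S * (1 - s) = orient b c d" "S * s = orient a b d"
    using S(1) by (simp_all add: s_def right_diff_distrib) (simp add: S_def)
  have bd: "S * (1 - t) = orient a c d" "S * t = orient a b c"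
    using S by (simp_all add: t_def right_diff_distrib)
  \<comment> \<open>This affine dependence of four points in the plane is a polynomial identity in
    their coordinates.\<close>
  have rel: "orient b c d *\<^sub>R a + orient a b d *\<^sub>R c = orient a c d *\<^sub>R b + orient a b c *\<^sub>R d"
    by (simp add: vec_eq_iff forall_2 orient_def algebra_simps)
  have "S *\<^sub>R ((1 - s) *\<^sub>R a + s *\<^sub>R c) = S *\<^sub>R ((1 - t) *\<^sub>R b + t *\<^sub>R d)"
    unfolding scaleR_add_right scaleR_scaleR ac bd by (rule rel)
  then have eq: "(1 - s) *\<^sub>R a + s *\<^sub>R c = (1 - t) *\<^sub>R b + t *\<^sub>R d"
    using S(1) by simp
  have "a \<noteq> c" "b \<noteq> d" using assms by auto
  then have "(1 - s) *\<^sub>R a + s *\<^sub>R c \<in> open_segment a c" "(1 - s) *\<^sub>R a + s *\<^sub>R c \<in> open_segment b d"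
    using s t eq unfolding in_segment by blast+
  then show thesis by (rule that)
qed

lemma orient_open_segment_pos:
  assumes "q \<in> open_segment c d" "orient a b c \<ge> 0" "orient a b d \<ge> 0"
    "orient a b c > 0 \<or> orient a b d > 0"
  shows "orient a b q > 0"
proof -
  obtain u where u: "0 < u" "u < 1" "q = (1 - u) *\<^sub>R c + u *\<^sub>R d"
    using assms(1) unfolding in_segment by blast
  have "orient a b q = (1 - u) * orient a b c + u * orient a b d"
    unfolding u(3) by (rule orient_affine) simp
  moreover have "(1 - u) * orient a b c \<ge> 0" "u * orient a b d \<ge> 0" using u assms by simp_all
  moreover have "(1 - u) * orient a b c > 0 \<or> u * orient a b d > 0"
    using u(1,2) assms(4) by (auto simp: zero_less_mult_iff)
  ultimately show ?thesis by linarith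
qed

lemma orient_open_segment_0:
  assumes "q \<in> open_segment a b"
  shows "orient a b q = 0"
proof -
  obtain u where u: "q = (1 - u) *\<^sub>R a + u *\<^sub>R b"
    using assms unfolding in_segment by blast
  have "orient a b q = (1 - u) * orient a b a + u * orient a b b"
    unfolding u by (rule orient_affine) simp
  then show ?thesis by simp
qed

text \<open>The second open segment lies strictly to the left of the line through \<open>a\<close>
  and \<open>b\<close>. One of the two signs may vanish, which admits chords with a common
  endpoint.\<close>

lemma disjoint_open_segments:
  assumes "orient a b c \<ge> 0" "orient a b d \<ge> 0" "orient a b c > 0 \<or> orient a b d > 0"
  shows "open_segment a b \<inter> open_segment c d = {}"
proof -
  have "q \<notin> open_segment c d" if "q \<in> open_segment a b" for q
    using orient_open_segment_0[OF that] orient_open_segment_pos[OF _ assms, of q] by auto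
  then show ?thesis by blast
qed

lemma ccw_pointsD:
  assumes "ccw_points n v" "i < j" "j < k" "k < n"
  shows "orient (v i) (v j) (v k) > 0" "orient (v j) (v k) (v i) > 0" "orient (v k) (v i) (v j) > 0"
    "orient (v i) (v k) (v j) < 0"
proof -
  show *: "orient (v i) (v j) (v k) > 0" using assms unfolding ccw_points_def by blast
  show "orient (v j) (v k) (v i) > 0" using * orient_rotate[of "v j" "v k" "v i"] by simp
  show "orient (v k) (v i) (v j) > 0" using * orient_rotate[of "v i" "v j" "v k"] by simp
  show "orient (v i) (v k) (v j) < 0" using * orient_flip[of "v i" "v k" "v j"] by simp
qed

lemma ccw_points_chord_sign:
  assumes "ccw_points n v" "i < j" "j < n" "k < n"
  shows "k < i \<or> j < k \<Longrightarrow> orient (v i) (v j) (v k) > 0"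
    and "i < k \<Longrightarrow> k < j \<Longrightarrow> orient (v i) (v j) (v k) < 0"
    and "k = i \<or> k = j \<Longrightarrow> orient (v i) (v j) (v k) = 0"
proof -
  show "orient (v i) (v j) (v k) > 0" if "k < i \<or> j < k"
    using that ccw_pointsD(1)[OF assms(1,2) _ assms(4)] ccw_pointsD(2)[OF assms(1) _ assms(2,3), of k]
    by blast
  show "orient (v i) (v j) (v k) < 0" if "i < k" "k < j"
    using ccw_pointsD(4)[OF assms(1) that assms(3)] .
  show "orient (v i) (v j) (v k) = 0" if "k = i \<or> k = j"
    using that by auto
qed

text \<open>A third index gives a triple with nonzero orientation, which rules out coinciding
  points.\<close>

lemma ccw_points_inj:
  assumes "ccw_points n v" "n \<ge> 3"
  shows "inj_on v {..<n}"
proof (rule linorder_inj_onI')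
  fix i j assume ij: "i \<in> {..<n}" "j \<in> {..<n}" "i < j"
  have "\<exists>k<3. k \<noteq> i \<and> k \<noteq> j" by presburger
  then obtain k where "k < 3" and k: "k \<noteq> i" "k \<noteq> j" by blast
  then have "k < n" using assms(2) by simp
  with k have "orient (v i) (v j) (v k) \<noteq> 0"
    using ccw_points_chord_sign[OF assms(1) ij(3), of k] ij
    by (cases "i < k \<and> k < j") auto
  then show "v i \<noteq> v j" by auto
qed

text \<open>If the index pairs are not linked, the ends \<open>k\<close> and \<open>l\<close> lie on
  the same closed side of the chord from \<open>i\<close> to \<open>j\<close>, and at least one of
  them lies strictly there.\<close>

lemma ccw_noncrossing:
  assumes v: "ccw_points n v" "n \<ge> 3" and ij: "i < j" "j < n" and kl: "k < l" "l < n"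
    and ne: "(i, j) \<noteq> (k, l)"
    and "\<not> (i < k \<and> k < j \<and> j < l)" "\<not> (k < i \<and> i < l \<and> l < j)"
  shows "noncrossing (closed_segment (v i) (v j)) (closed_segment (v k) (v l))"
proof -
  have d: "v i \<noteq> v j" "v k \<noteq> v l"
    using ccw_points_inj[OF v] ij kl by (auto simp: inj_on_def)
  have kn: "k < n" using kl by simp
  note sk = ccw_points_chord_sign[OF v(1) ij kn] and sl = ccw_points_chord_sign[OF v(1) ij kl(2)]
  consider (inside) "i \<le> k" "l \<le> j" | (outside) "k \<le> i \<or> j \<le> k" "l \<le> i \<or> j \<le> l"
    using assms by linarith
  then have "open_segment (v i) (v j) \<inter> open_segment (v k) (v l) = {}"
  proof cases
    case inside
    have "orient (v i) (v j) (v k) \<le> 0" using sk inside kl by (cases "i = k") auto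
    moreover have "orient (v i) (v j) (v l) \<le> 0" using sl inside kl by (cases "l = j") auto
    moreover have "orient (v i) (v j) (v k) < 0 \<or> orient (v i) (v j) (v l) < 0"
      using sk(2) sl(2) inside kl ne by (cases "i = k") auto
    \<comment> \<open>Points with indices between \<open>i\<close> and \<open>j\<close> lie to the
      right of the chord, so the chord is reversed.\<close>
    ultimately have "open_segment (v j) (v i) \<inter> open_segment (v k) (v l) = {}"
      by (intro disjoint_open_segments) (simp_all add: orient_swap[of "v j" "v i"])
    then show ?thesis by (simp add: open_segment_commute)
  next
    case outside
    show ?thesis
    proof (rule disjoint_open_segments)
      show "orient (v i) (v j) (v k) \<ge> 0" using sk outside by (cases "k = i \<or> k = j") force+
      show "orient (v i) (v j) (v l) \<ge> 0" using sl outside by (cases "l = i \<or> l = j") force+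
      have "k < i \<or> j < k \<or> l < i \<or> j < l" using outside kl ij ne by auto
      then show "orient (v i) (v j) (v k) > 0 \<or> orient (v i) (v j) (v l) > 0"
        using sk(1) sl(1) by blast
    qed
  qed
  then show ?thesis using noncrossing_segments[OF d] by blast
qed

text \<open>Reduces the geometry to a comparison of indices. One linking pattern suffices in the
  hypothesis, since the other arises by exchanging the two pairs.\<close>

lemma ccw_chords_noncrossing:
  assumes v: "ccw_points n v" "n \<ge> 3" and D: "D \<subseteq> {(i, j). i < j \<and> j < n}"
    and nonlinked: "\<And>i j k l. (i, j) \<in> D \<Longrightarrow> (k, l) \<in> D \<Longrightarrow> \<not> (i < k \<and> k < j \<and> j < l)"
  shows "pairwise noncrossing ((\<lambda>(i, j). closed_segment (v i) (v j)) ` D)"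
proof (rule pairwiseI)
  have arc: "\<exists>i j. (i, j) \<in> D \<and> s = closed_segment (v i) (v j)"
    if s: "s \<in> (\<lambda>(i, j). closed_segment (v i) (v j)) ` D" for s
  proof -
    obtain x where "s = (\<lambda>(i, j). closed_segment (v i) (v j)) x" "x \<in> D" using s by (rule imageE)
    moreover obtain i j where "x = (i, j)" by (rule prod.exhaust)
    ultimately show ?thesis by (intro exI[of _ i] exI[of _ j]) simp
  qed
  fix s t
  assume s: "s \<in> (\<lambda>(i, j). closed_segment (v i) (v j)) ` D"
    and t: "t \<in> (\<lambda>(i, j). closed_segment (v i) (v j)) ` D" and "s \<noteq> t"
  obtain i j where ij: "(i, j) \<in> D" "s = closed_segment (v i) (v j)" using arc[OF s] by blast
  obtain k l where kl: "(k, l) \<in> D" "t = closed_segment (v k) (v l)" using arc[OF t] by blast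
  note st = ij kl
  have "i < j" "j < n" "k < l" "l < n" using st(1,3) D by auto
  moreover have "(i, j) \<noteq> (k, l)" using st(2,4) \<open>s \<noteq> t\<close> by blast
  ultimately show "noncrossing s t"
    unfolding st(2,4) by (intro ccw_noncrossing[OF v] nonlinked[OF st(1,3)] nonlinked[OF st(3,1)])
qed

section \<open>Walks in the flip-graphs\<close>

text \<open>\<open>D\<close> may be any finite part of the difference, so that the induction can
  drop from it the single arc lost in the first flip.\<close>

lemma vwalk_flip_graph_length:
  assumes "vwalk g (with_proj (flip_graph M))" "finite D" "D \<subseteq> hd g - last g"
  shows "card D \<le> vwalk_length g"
  using assms
proof (induction g arbitrary: D rule: vwalk_arcs.induct)
  case (3 S T g)
  have w: "vwalk (T # g) (with_proj (flip_graph M))"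
    using 3(2) by (auto simp: vwalk_def)
  have "(S, T) \<in> parcs (flip_graph M)"
    using 3(2) by (auto simp: vwalk_def)
  then obtain e where e: "S - T = {e}"
    by (auto simp: flip_graph_def differ_by_one_arc_def)
  have "D - {e} \<subseteq> hd (T # g) - last (T # g)"
    using 3(4) e by auto
  then have "card (D - {e}) \<le> vwalk_length (T # g)"
    using 3(1)[OF w] 3(3) by blast
  moreover have "card D \<le> card (D - {e}) + 1"
    using 3(3) by (simp add: card_Diff_singleton_if) linarith
  ultimately show ?case by simp
qed (auto simp: vwalk_def)

text \<open>The walk leaves the punctured level at \<open>T 0\<close>, follows the \<open>k\<close>
  flips and returns from \<open>T k\<close>, which makes \<open>k + 2\<close> steps. Injectivity of
  \<open>T\<close> is there because a \<open>vpath\<close> repeats no vertex.\<close>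

lemma walk_in_extended_flip_graph:
  assumes path: "\<forall>i < k. (T i, T (Suc i)) \<in> parcs (flip_graph (vertices P))"
    and T: "\<forall>i \<le> k. T i \<in> triangulations (vertices P)" "inj_on T {..k}"
    and U: "U \<in> triangulations (insert p (vertices P))" "flips_puncture_into p (T 0) U"
    and V: "V \<in> triangulations (insert p (vertices P))" "flips_puncture_into p (T k) V"
    and "U \<noteq> V"
  shows "path_between (extended_flip_graph P p) (Inr U)
    (Inr U # map (Inl \<circ> T) [0..<Suc k] @ [Inr V]) (Inr V)"
proof -
  let ?G = "extended_flip_graph P p"
  \<comment> \<open>The start \<open>i\<close> is generalised so that the induction can run over the
    number \<open>k - i\<close> of flips still to be made.\<close>
  have arcs: "set (vwalk_arcs (map (Inl \<circ> T) [i..<Suc k] @ [Inr V])) \<subseteq> parcs ?G" if "i \<le> k" for i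
    using that
  proof (induction "k - i" arbitrary: i)
    case 0
    then have "i = k" by simp
    moreover have "(Inl (T k), Inr V) \<in> parcs ?G"
      using V T(1) by (force simp: extended_flip_graph_def Let_def flip_graph_def)
    ultimately show ?case by simp
  next
    case (Suc m)
    then have i: "i < k" by simp
    then have "[i..<Suc k] = i # Suc i # [Suc (Suc i)..<Suc k]" by (simp add: upt_conv_Cons)
    moreover have "[Suc i..<Suc k] = Suc i # [Suc (Suc i)..<Suc k]" using i by (simp add: upt_conv_Cons)
    moreover have "(Inl (T i), Inl (T (Suc i))) \<in> parcs ?G"
      using path i by (force simp: extended_flip_graph_def Let_def)
    moreover have "set (vwalk_arcs (map (Inl \<circ> T) [Suc i..<Suc k] @ [Inr V])) \<subseteq> parcs ?G"
      using Suc i by simp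
    ultimately show ?case by simp
  qed
  \<comment> \<open>Removing the puncture uses the converse half of the edges between the two
    levels.\<close>
  have "(Inr U, Inl (T 0)) \<in> parcs ?G"
    using U T(1) by (force simp: extended_flip_graph_def Let_def flip_graph_def)
  then have "set (vwalk_arcs (Inr U # map (Inl \<circ> T) [0..<Suc k] @ [Inr V])) \<subseteq> parcs ?G"
    using arcs[of 0] by (simp add: upt_conv_Cons del: upt_Suc)
  moreover have "set (Inr U # map (Inl \<circ> T) [0..<Suc k] @ [Inr V]) \<subseteq> pverts ?G"
    using U(1) V(1) T(1) by (auto simp: extended_flip_graph_def Let_def flip_graph_def)
  moreover have "distinct (Inr U # map (Inl \<circ> T) [0..<Suc k] @ [Inr V])"
    using \<open>U \<noteq> V\<close> T(2) by (auto simp: distinct_map inj_on_def simp del: upt_Suc)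
  ultimately show ?thesis
    unfolding path_between_def vpath_def vwalk_def by simp
qed

text \<open>A geodesic is at most as long as \<open>h\<close>, whereas a path staying in the
  flip-graph on \<open>M\<close> must lose every arc of \<open>D\<close>, one per step.\<close>

lemma no_geodesic_in_flip_graph:
  assumes h: "path_between (extended_flip_graph P p) (Inr U) h (Inr V)"
    and D: "finite D" "D \<subseteq> U - V" "vwalk_length h < card D"
  shows "\<not> (\<exists>g. geodesic (extended_flip_graph P p) (Inr U) (map Inr g) (Inr V) \<and>
    vpath g (with_proj (flip_graph M)))"
proof
  assume "\<exists>g. geodesic (extended_flip_graph P p) (Inr U) (map Inr g) (Inr V) \<and>
    vpath g (with_proj (flip_graph M))"
  then obtain g where g: "geodesic (extended_flip_graph P p) (Inr U) (map Inr g) (Inr V)"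
      "vpath g (with_proj (flip_graph M))" by blast
  have w: "vwalk g (with_proj (flip_graph M))" using g(2) by (simp add: vpath_def)
  then have "g \<noteq> []" by (simp add: vwalk_def)
  then have "hd g = U" "last g = V"
    using g(1) by (auto simp: geodesic_def path_between_def hd_map last_map)
  then have "card D \<le> length g - 1" using vwalk_flip_graph_length[OF w D(1)] D(2) by simp
  moreover have "length g - 1 \<le> length h - 1"
    using g(1) h unfolding geodesic_def by (metis length_map vwalk_length_simp)
  ultimately show False using D(3) by simp
qed

section \<open>The hexagon: overlapping triangles, three flips and the detour\<close>

lemma ccw_triangles_overlap:
  assumes "ccw_points 6 v"
  obtains p where "p \<in> interior (convex hull {v 0, v 3, v 5})"
    "p \<in> interior (convex hull {v 1, v 2, v 4})"
proof -
  note v = ccw_pointsD[OF assms]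
  \<comment> \<open>The instantiation follows the order of occurrence \<open>b c d a\<close>, so
    \<open>x\<close> comes from the quadrilateral 0134 and \<open>y\<close> below from 2345.\<close>
  obtain x where x: "x \<in> open_segment (v 0) (v 3)" "x \<in> open_segment (v 1) (v 4)"
    using crossing_diagonals[of "v 1" "v 3" "v 4" "v 0"] v(1) by auto
  obtain y where y: "y \<in> open_segment (v 2) (v 4)" "y \<in> open_segment (v 3) (v 5)"
    using crossing_diagonals[of "v 3" "v 4" "v 5" "v 2"] v(1) by auto
  \<comment> \<open>The point \<open>x\<close> lies on the sides 03 and 14 of the two triangles, and
    \<open>y\<close> on the sides 35 and 24. Both are weakly inside all six sides and no side
    contains both, so their midpoint is strictly inside both triangles.\<close>
  define p where "p = (1/2) *\<^sub>R x + (1/2) *\<^sub>R y"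
  have p: "orient a b p > 0" if "orient a b x \<ge> 0" "orient a b y \<ge> 0" "orient a b x > 0 \<or> orient a b y > 0" for a b
  proof -
    have "orient a b p = (1/2) * orient a b x + (1/2) * orient a b y"
      unfolding p_def by (rule orient_affine) simp
    then show ?thesis using that by auto
  qed
  have x': "orient (v 0) (v 3) x = 0" "orient (v 4) (v 1) x = 0"
    "orient (v 3) (v 5) x > 0" "orient (v 5) (v 0) x > 0" "orient (v 1) (v 2) x > 0" "orient (v 2) (v 4) x > 0"
  proof -
    show "orient (v 0) (v 3) x = 0" by (rule orient_open_segment_0[OF x(1)])
    show "orient (v 4) (v 1) x = 0"
      using x(2) by (intro orient_open_segment_0) (simp add: open_segment_commute)
    show "orient (v 3) (v 5) x > 0"
      by (rule orient_open_segment_pos[OF x(1)]) (use v(2)[of 0 3 5] in simp_all)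
    show "orient (v 5) (v 0) x > 0"
      by (rule orient_open_segment_pos[OF x(1)]) (use v(3)[of 0 3 5] in simp_all)
    show "orient (v 1) (v 2) x > 0"
      by (rule orient_open_segment_pos[OF x(2)]) (use v(1)[of 1 2 4] in simp_all)
    show "orient (v 2) (v 4) x > 0"
      by (rule orient_open_segment_pos[OF x(2)]) (use v(2)[of 1 2 4] in simp_all)
  qed
  have y': "orient (v 3) (v 5) y = 0" "orient (v 2) (v 4) y = 0"
    "orient (v 0) (v 3) y > 0" "orient (v 5) (v 0) y > 0" "orient (v 1) (v 2) y > 0" "orient (v 4) (v 1) y > 0"
  proof -
    show "orient (v 3) (v 5) y = 0" by (rule orient_open_segment_0[OF y(2)])
    show "orient (v 2) (v 4) y = 0" by (rule orient_open_segment_0[OF y(1)])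
    show "orient (v 0) (v 3) y > 0"
      by (rule orient_open_segment_pos[OF y(2)]) (use v(1)[of 0 3 5] in simp_all)
    show "orient (v 5) (v 0) y > 0"
      by (rule orient_open_segment_pos[OF y(2)]) (use v(3)[of 0 3 5] in simp_all)
    show "orient (v 1) (v 2) y > 0"
      by (rule orient_open_segment_pos[OF y(1)]) (use v(1)[of 1 2 4] in simp_all)
    show "orient (v 4) (v 1) y > 0"
      by (rule orient_open_segment_pos[OF y(1)]) (use v(3)[of 1 2 4] in simp_all)
  qed
  have "p \<in> interior (convex hull {v 0, v 3, v 5})" "p \<in> interior (convex hull {v 1, v 2, v 4})"
    by (intro in_triangle p; use x' y' in simp)+
  then show thesis by (rule that)
qed

theorem theorem5p7:
  fixes n :: nat and P :: "(real^2) set"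
  assumes "n \<ge> 7" and "convex_ngon n P"
  shows "\<exists>p \<in> interior P.
    \<exists>U \<in> triangulations (insert p (vertices P)). \<exists>V \<in> triangulations (insert p (vertices P)).
      \<not> (\<exists>g. geodesic (extended_flip_graph P p) (Inr U) (map Inr g) (Inr V) \<and>
             vpath g (with_proj (flip_graph (insert p (vertices P)))))"
proof -
  define M where "M = vertices P"
  have convP: "convex P" and card: "card M = n"
    using assms(2) polytope_imp_convex unfolding convex_ngon_def M_def by blast+
  have fin: "finite M" using card assms(1) by (intro card_ge_0_finite) simp
  have ci: "convexly_independent M"
    unfolding M_def by (rule convexly_independent_vertices[OF convP])
  obtain xs where xs: "set xs = M" "length xs \<ge> card M" "ccw_points (length xs) ((!) xs)"
    by (rule counterclockwise_enumeration[OF ci fin])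
  define v where "v = (!) xs"
  \<comment> \<open>The first six points of the enumeration form the hexagon.\<close>
  have len: "6 \<le> length xs" using xs(2) card assms(1) by simp
  have vM: "v i \<in> M" if "i < 6" for i using that len xs(1) unfolding v_def by auto
  have ccw: "ccw_points 6 v" using xs(3) len unfolding ccw_points_def v_def
    by (meson less_le_trans)
  have inj: "v i = v j \<longleftrightarrow> i = j" if "i < 6" "j < 6" for i j
    using ccw_points_inj[OF ccw] that by (auto simp: inj_on_def)
  obtain p where p: "p \<in> interior (convex hull {v 0, v 3, v 5})"
      "p \<in> interior (convex hull {v 1, v 2, v 4})"
    by (rule ccw_triangles_overlap[OF ccw])

  define c where "c i j = closed_segment (v i) (v j)" for i j
  \<comment> \<open>Chords are compared through their index pairs, up to order; the later membership
    claims are decided in this way.\<close>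
  have c_eq: "c i j = c k l \<longleftrightarrow> i = k \<and> j = l \<or> i = l \<and> j = k" if "i < 6" "j < 6" "k < 6" "l < 6" for i j k l
    unfolding c_def closed_segment_eq doubleton_eq_iff using inj that by simp
  have c_swap: "c i j = c j i" if "j < i" for i j
    unfolding c_def by (rule closed_segment_commute)
  have cross: "\<exists>q. q \<in> open_segment (v i) (v k) \<and> q \<in> open_segment (v j) (v l)"
    if "i < j" "j < k" "k < l" "l < 6" for i j k l
  proof -
    have "i < k" "j < l" "k < 6" using that by simp_all
    then have o: "orient (v j) (v k) (v l) > 0" "orient (v i) (v j) (v l) > 0"
        "orient (v i) (v k) (v l) > 0" "orient (v i) (v j) (v k) > 0"
      using that ccw_pointsD(1)[OF ccw] by simp_all
    show ?thesis using crossing_diagonals[OF o] by blast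
  qed
  have triI: "triangle_of T (v i) (v j) (v k)"
    if "c i j \<in> T" "c j k \<in> T" "c i k \<in> T" "i \<noteq> j" "j \<noteq> k" "i \<noteq> k" "i < 6" "j < 6" "k < 6" for T i j k
    using that inj unfolding triangle_of_def c_def by simp
  have flip: "insert (c j l) (T - {c i k}) \<in> triangulations M \<and>
      differ_by_one_arc T (insert (c j l) (T - {c i k}))"
    if "T \<in> triangulations M" "triangle_of T (v i) (v j) (v k)" "triangle_of T (v i) (v l) (v k)"
      "\<exists>q. q \<in> open_segment (v i) (v k) \<and> q \<in> open_segment (v j) (v l)"
      "i < 6" "j < 6" "k < 6" "l < 6" "j \<noteq> l" for T i j k l
    using flip_triangulation[OF ci that(1) vM[OF that(5)] vM[OF that(6)] vM[OF that(7)] vM[OF that(8)] _ that(2,3)]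
      that(4,9) inj[OF that(6,8)] unfolding c_def by blast

  \<comment> \<open>The six sides of the hexagon and the diagonals 03, 35, 13. Any triangulation
    \<open>T0\<close> containing these chords will do; it also fills the rest of the
    polygon.\<close>
  define D :: "(nat \<times> nat) set"
    where "D = {(0, 1), (1, 2), (2, 3), (3, 4), (4, 5), (0, 5), (0, 3), (3, 5), (1, 3)}"
  define S where "S = (\<lambda>(i, j). c i j) ` D"
  have "pairwise noncrossing S"
    unfolding S_def c_def by (rule ccw_chords_noncrossing[OF ccw]) (auto simp: D_def)
  moreover have "S \<subseteq> marked_arcs M"
    unfolding S_def c_def using vM inj
    by (auto simp: D_def intro!: marked_arc_independent[OF ci])
  ultimately have "S \<in> noncrossing_arc_sets M" by (simp add: noncrossing_arc_sets_def)
  then obtain T0 where T0: "T0 \<in> triangulations M" "S \<subseteq> T0"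
    by (rule triangulation_extending[OF fin])
  have T0_mem: "c 0 1 \<in> T0" "c 1 2 \<in> T0" "c 2 3 \<in> T0" "c 3 4 \<in> T0" "c 4 5 \<in> T0" "c 0 5 \<in> T0"
    "c 0 3 \<in> T0" "c 3 5 \<in> T0" "c 1 3 \<in> T0"
    using T0(2) unfolding S_def D_def by auto
  have T0_mem': "c 3 0 \<in> T0" "c 4 3 \<in> T0"
    using T0_mem c_swap[of 0 3] c_swap[of 3 4] by simp_all

  \<comment> \<open>First flip: 35 becomes 04 in the quadrilateral 0345.\<close>
  define T1 where "T1 = insert (c 0 4) (T0 - {c 3 5})"
  have "\<exists>q. q \<in> open_segment (v 3) (v 5) \<and> q \<in> open_segment (v 0) (v 4)"
    using cross[of 0 3 4 5] by auto
  moreover have "triangle_of T0 (v 3) (v 0) (v 5)" "triangle_of T0 (v 3) (v 4) (v 5)"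
    by (rule triI; simp add: T0_mem T0_mem')+
  ultimately have T1: "T1 \<in> triangulations M" "differ_by_one_arc T0 T1"
    using flip[OF T0(1), of 3 0 5 4] unfolding T1_def by simp_all
  have T1_mem: "c 0 1 \<in> T1" "c 1 3 \<in> T1" "c 0 3 \<in> T1" "c 1 2 \<in> T1" "c 2 3 \<in> T1" "c 0 4 \<in> T1" "c 4 3 \<in> T1"
    unfolding T1_def by (simp_all add: T0_mem T0_mem' c_eq del: One_nat_def)

  \<comment> \<open>Second flip: 03 becomes 14 in the quadrilateral 0134.\<close>
  define T2 where "T2 = insert (c 1 4) (T1 - {c 0 3})"
  have "triangle_of T1 (v 0) (v 1) (v 3)" "triangle_of T1 (v 0) (v 4) (v 3)"
    by (rule triI; simp add: T1_mem del: One_nat_def)+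
  then have T2: "T2 \<in> triangulations M" "differ_by_one_arc T1 T2"
    using flip[OF T1(1), of 0 1 3 4] cross[of 0 1 3 4] unfolding T2_def by (simp_all del: One_nat_def)
  have T2_mem: "c 1 2 \<in> T2" "c 2 3 \<in> T2" "c 1 3 \<in> T2" "c 1 4 \<in> T2" "c 4 3 \<in> T2"
    unfolding T2_def by (simp_all add: T1_mem c_eq del: One_nat_def)

  \<comment> \<open>Third flip: 13 becomes 24 in the quadrilateral 1234, which completes the
    triangle 124.\<close>
  define T3 where "T3 = insert (c 2 4) (T2 - {c 1 3})"
  have "triangle_of T2 (v 1) (v 2) (v 3)" "triangle_of T2 (v 1) (v 4) (v 3)"
    by (rule triI; simp add: T2_mem del: One_nat_def)+
  then have T3: "T3 \<in> triangulations M" "differ_by_one_arc T2 T3"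
    using flip[OF T2(1), of 1 2 3 4] cross[of 1 2 3 4] unfolding T3_def by (simp_all del: One_nat_def)
  have T3_mem: "c 1 2 \<in> T3" "c 2 4 \<in> T3" "c 1 4 \<in> T3"
    unfolding T3_def by (simp_all add: T2_mem c_eq del: One_nat_def)

  \<comment> \<open>The puncture lies in the open triangle 035 of \<open>T0\<close> and in the open
    triangle 124 of \<open>T3\<close>, so the first case of \<open>flips_puncture_into\<close>
    applies at both ends.\<close>
  define U where "U = T0 \<union> {closed_segment p (v 0), closed_segment p (v 3), closed_segment p (v 5)}"
  define V where "V = T3 \<union> {closed_segment p (v 1), closed_segment p (v 2), closed_segment p (v 4)}"
  have tri0: "triangle_of T0 (v 0) (v 3) (v 5)" by (rule triI) (simp_all add: T0_mem)
  have tri3: "triangle_of T3 (v 1) (v 2) (v 4)"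
    by (rule triI) (simp_all add: T3_mem del: One_nat_def)
  have sub: "{v 0, v 3, v 5} \<subseteq> M" "{v 1, v 2, v 4} \<subseteq> M" using vM by simp_all
  have U: "U \<in> triangulations (insert p M)" "flips_puncture_into p T0 U"
    unfolding U_def flips_puncture_into_def
    using puncture_triangulation[OF ci T0(1) tri0 sub(1) p(1)] tri0 p(1) by blast+
  have V: "V \<in> triangulations (insert p M)" "flips_puncture_into p T3 V"
    unfolding V_def flips_puncture_into_def
    using puncture_triangulation[OF ci T3(1) tri3 sub(2) p(2)] tri3 p(2) by blast+

  have pM: "p \<notin> M" using interior_triangle_Int_independent[OF ci sub(1)] p(1) by blast
  \<comment> \<open>Arcs of \<open>T3\<close> have both ends in \<open>M\<close>, and a segment
    determines its endpoints.\<close>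
  have spoke: "closed_segment p x \<notin> T3" for x
  proof
    assume "closed_segment p x \<in> T3"
    then obtain a b where "closed_segment p x = closed_segment a b" "a \<in> M" "b \<in> M"
      using marked_arcE subsetD[OF triangulationD(1)[OF T3(1)]] by metis
    then have "p \<in> {a, b}" unfolding closed_segment_eq by blast
    then show False using pM \<open>a \<in> M\<close> \<open>b \<in> M\<close> by blast
  qed
  have pv: "p \<noteq> v i" if "i < 6" for i using vM[OF that] pM by blast
  define r where "r i = closed_segment p (v i)" for i
  have r_eq: "r i = r j \<longleftrightarrow> i = j" if "i < 6" "j < 6" for i j
    unfolding r_def closed_segment_eq using inj[OF that] pv that by (auto simp: doubleton_eq_iff)
  have r_c: "r i \<noteq> c j k" "c j k \<noteq> r i" if "j < 6" "k < 6" for i j k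
    unfolding r_def c_def closed_segment_eq using pv that by (auto simp: doubleton_eq_iff)
  have r_T3: "r i \<notin> T3" for i unfolding r_def by (rule spoke)
  \<comment> \<open>The three diagonals that were flipped away and the three arcs at
    \<open>p\<close> in \<open>U\<close>; the arcs at \<open>p\<close> in \<open>V\<close> end at
    the other three vertices of the hexagon.\<close>
  define E where "E = {c 3 5, c 0 3, c 1 3, r 0, r 3, r 5}"
  have "card E = 6"
    unfolding E_def by (simp add: c_eq r_eq r_c del: One_nat_def)
  moreover have "E \<subseteq> U - V"
    unfolding E_def U_def V_def r_def[symmetric]
    by (simp add: T0_mem r_T3 r_c r_eq del: One_nat_def)
      (simp add: T3_def T2_def T1_def c_eq del: One_nat_def)
  moreover have "finite E" by (simp add: E_def)
  ultimately have E: "finite E" "E \<subseteq> U - V" "card E = 6" by blast+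
  then have "U \<noteq> V" by auto

  define T where "T = (!) [T0, T1, T2, T3]"
  have T_simps: "T 0 = T0" "T (Suc 0) = T1" "T (Suc (Suc 0)) = T2" "T (Suc (Suc (Suc 0))) = T3"
    by (simp_all add: T_def)
  \<comment> \<open>Each diagonal that is flipped away never returns, so it separates the
    triangulation just before its flip from all later ones.\<close>
  have "c 3 5 \<in> T0 - T1" "c 3 5 \<in> T0 - T2" "c 3 5 \<in> T0 - T3" "c 0 3 \<in> T1 - T2" "c 0 3 \<in> T1 - T3"
    "c 1 3 \<in> T2 - T3"
    by (simp_all add: T3_def T2_def T1_def T0_mem c_eq del: One_nat_def)
  then have neq: "T0 \<noteq> T1" "T0 \<noteq> T2" "T0 \<noteq> T3" "T1 \<noteq> T2" "T1 \<noteq> T3" "T2 \<noteq> T3" by blast+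
  have path: "path_between (extended_flip_graph P p) (Inr U)
      (Inr U # map (Inl \<circ> T) [0..<Suc 3] @ [Inr V]) (Inr V)"
  proof (rule walk_in_extended_flip_graph)
    show "\<forall>i<3. (T i, T (Suc i)) \<in> parcs (flip_graph (vertices P))"
      using T0(1) T1 T2 T3
      by (simp add: flip_graph_def M_def numeral_3_eq_3 All_less_Suc2 T_simps)
    show "\<forall>i\<le>3. T i \<in> triangulations (vertices P)"
      using T0(1) T1(1) T2(1) T3(1)
      by (simp add: M_def numeral_3_eq_3 le_Suc_eq all_conj_distrib T_simps)
    show "inj_on T {..3}"
      using neq neq[symmetric] by (simp add: numeral_3_eq_3 atMost_Suc T_simps)
    show "U \<in> triangulations (insert p (vertices P))" "V \<in> triangulations (insert p (vertices P))"
      using U(1) V(1) by (simp_all add: M_def)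
    show "flips_puncture_into p (T 0) U" "flips_puncture_into p (T 3) V"
      using U(2) V(2) by (simp_all add: T_simps numeral_3_eq_3)
  qed (rule \<open>U \<noteq> V\<close>)
  \<comment> \<open>The path above has six vertices, hence five steps, against the six arcs of
    \<open>E\<close>.\<close>
  have nog: "\<not> (\<exists>g. geodesic (extended_flip_graph P p) (Inr U) (map Inr g) (Inr V) \<and>
      vpath g (with_proj (flip_graph (insert p M))))"
    by (rule no_geodesic_in_flip_graph[OF path E(1,2)]) (simp add: E(3))
  \<comment> \<open>The puncture is inside a triangle with corners in \<open>P\<close>, hence in the
    interior of \<open>P\<close>.\<close>
  have "{v 0, v 3, v 5} \<subseteq> P" using sub(1) unfolding M_def vertices_def extreme_point_of_def by blast
  then have "convex hull {v 0, v 3, v 5} \<subseteq> P" using convP by (rule hull_minimal)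
  then have "p \<in> interior P" using p(1) interior_mono by blast
  then show ?thesis using U(1) V(1) nog unfolding M_def by blast
qed

end
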